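(* Let $F$ and $B$ be graphs that are $k_F$-edge connected and $k_B$-edge connected, respectively, and let $G$ be a Cartesian graph bundle with fibre $F$ over the base graph $B$. Let $a,b$ be integers with $0\leq a<k_F$ and $0\leq b<k_B$. If $\mathcal{D}^E_{a}(F)\geq 2$ and $\mathcal{D}^E_{b}(B)\geq 2$, then $$\mathcal{D}^E_{a+b+1}(G)\leq \mathcal{D}^E_{a}(F)+\mathcal{D}^E_{b}(B).$$
   Context: All graphs are simple (undirected, no loops or multiple edges). $d_G(x,y)$ is the length of a shortest path between $x$ and $y$ in $G$ ($\infty$ if there is none), and the diameter $\mathcal{D}(G)$ of a connected graph $G$ is the maximum distance between two of its vertices. By convention $K_1$ is disconnected. Edge connectivity: for a connected graph $G$, $\lambda(G)$ is the smallest number of edges whose removal disconnects $G$. $G$ is $k$-edge connected if $0<k\leq\lambda(G)$. Deletion: for $X\subseteq E(G)$, $G\setminus X$ is the graph $(V(G),E(G)\setminus X)$. Edge fault diameter: for a $k$-edge connected graph $G$ and $0\leq a<k$, the $a$-edge fault diameter is $$\mathcal{D}^E_a(G)=\max\{\mathcal{D}(G\setminus X) \mid X\subseteq E(G), |X|=a\},$$ with $\mathcal{D}^E_a(G)=\infty$ if $a\geq\lambda(G)$. Cartesian product: $G_1\Box G_2$ has vertex set $V(G_1)\times V(G_2)$, and $(u_1,v_1)$, $(u_2,v_2)$ are adjacent if either $u_1u_2\in E(G_1)$ and $v_1=v_2$, or $v_1v_2\in E(G_2)$ and $u_1=u_2$. Cartesian graph bundle: a graph $G$ is a Cartesian graph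 bundle with fibre $F$ over the base graph $B$ if there is a graph map $p:G\to B$, i.e. a map $p:V(G)\cup E(G)\to V(B)\cup E(B)$ sending vertices to vertices and edges to vertices or edges (compatibly with incidence), such that for each vertex $v\in V(B)$ the subgraph $p^{-1}(\{v\})$ (the fibre over $v$) is isomorphic to $F$, and for each edge $e=uv\in E(B)$, $p^{-1}(\{e\})$ is isomorphic to $F\Box K_2$; here $p^{-1}(\{e\})$ is understood as the subgraph formed by the two fibres over $u$ and $v$ together with all edges of $G$ mapped to $e$, the two fibres corresponding to the two copies of $F$ in $F\Box K_2$, so that the edges mapped to $e$ form a perfect matching between the two fibres inducing a graph isomorphism $\varphi_e:p^{-1}(\{u\})\to p^{-1}(\{v\})$. *)

theory Defs
  imports "HOL-Library.Extended_Nat"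
begin

datatype 'a sgraph = SGraph (verts: "'a set") (edges: "'a set set")

text \<open>Graphs are finite, so that the maxima in the definitions of the diameter and of the
  edge fault diameter exist.\<close>

definition simple_graph :: "'a sgraph \<Rightarrow> bool" where
  "simple_graph G \<longleftrightarrow> finite (verts G) \<and> (\<forall>e\<in>edges G. e \<subseteq> verts G \<and> card e = 2)"

text \<open>A path is given by the list of its (pairwise distinct) vertices; it has
  \<open>length xs - 1\<close> edges.\<close>

definition is_path :: "'a sgraph \<Rightarrow> 'a \<Rightarrow> 'a list \<Rightarrow> 'a \<Rightarrow> bool" where
  "is_path G x xs y \<longleftrightarrow>
     xs \<noteq> [] \<and> hd xs = x \<and> last xs = y \<and> distinct xs \<and> set xs \<subseteq> verts G \<and>
     (\<forall>i. Suc i < length xs \<longrightarrow> {xs ! i, xs ! Suc i} \<in> edges G)"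

text \<open>The infimum of the empty set of extended naturals is \<open>\<infinity>\<close>.\<close>

definition graph_dist :: "'a sgraph \<Rightarrow> 'a \<Rightarrow> 'a \<Rightarrow> enat" where
  "graph_dist G x y = (INF xs\<in>{xs. is_path G x xs y}. enat (length xs - 1))"

definition diameter :: "'a sgraph \<Rightarrow> enat" where
  "diameter G = Max {graph_dist G x y | x y. x \<in> verts G \<and> y \<in> verts G}"

text \<open>By convention the one-vertex graph is disconnected (and so is the empty graph).\<close>

definition graph_connected :: "'a sgraph \<Rightarrow> bool" where
  "graph_connected G \<longleftrightarrow>
     1 < card (verts G) \<and> (\<forall>x\<in>verts G. \<forall>y\<in>verts G. \<exists>xs. is_path G x xs y)"

definition delete_edges :: "'a sgraph \<Rightarrow> 'a set set \<Rightarrow> 'a sgraph" where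
  "delete_edges G X = SGraph (verts G) (edges G - X)"

text \<open>For a connected finite graph the minimum exists, since deleting all edges disconnects it.
  For a disconnected graph the value is 0.\<close>

definition edge_connectivity :: "'a sgraph \<Rightarrow> nat" where
  "edge_connectivity G =
     (LEAST n. \<exists>X\<subseteq>edges G. card X = n \<and> \<not> graph_connected (delete_edges G X))"

definition edge_connected :: "nat \<Rightarrow> 'a sgraph \<Rightarrow> bool" where
  "edge_connected k G \<longleftrightarrow> graph_connected G \<and> 0 < k \<and> k \<le> edge_connectivity G"

definition edge_fault_diameter :: "nat \<Rightarrow> 'a sgraph \<Rightarrow> enat" where
  "edge_fault_diameter a G =
     (if a < edge_connectivity G
      then Max {diameter (delete_edges G X) | X. X \<subseteq> edges G \<and> card X = a}
      else \<infinity>)"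

definition cartesian_product :: "'a sgraph \<Rightarrow> 'b sgraph \<Rightarrow> ('a \<times> 'b) sgraph" where
  "cartesian_product G H = SGraph (verts G \<times> verts H)
     {{(u1, v1), (u2, v2)} | u1 v1 u2 v2.
        {u1, u2} \<in> edges G \<and> v1 = v2 \<and> v1 \<in> verts H \<or>
        {v1, v2} \<in> edges H \<and> u1 = u2 \<and> u1 \<in> verts G}"

definition K2 :: "bool sgraph" where
  "K2 = SGraph {False, True} {{False, True}}"

definition graph_iso :: "('a \<Rightarrow> 'b) \<Rightarrow> 'a sgraph \<Rightarrow> 'b sgraph \<Rightarrow> bool" where
  "graph_iso f G H \<longleftrightarrow>
     bij_betw f (verts G) (verts H) \<and>
     (\<forall>x\<in>verts G. \<forall>y\<in>verts G. {x, y} \<in> edges G \<longleftrightarrow> {f x, f y} \<in> edges H)"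

text \<open>The disjoint union \<open>V(G) \<union> E(G)\<close>, on which graph maps are defined.\<close>

datatype 'a graph_elem = Vertex 'a | Edge "'a set"

text \<open>An edge mapped to a vertex has both its end vertices mapped to that vertex; an edge mapped
  to an edge has its end vertices mapped onto the end vertices of the latter.\<close>

definition graph_map :: "('g graph_elem \<Rightarrow> 'b graph_elem) \<Rightarrow> 'g sgraph \<Rightarrow> 'b sgraph \<Rightarrow> bool" where
  "graph_map p G B \<longleftrightarrow>
     (\<forall>x\<in>verts G. p (Vertex x) \<in> Vertex ` verts B) \<and>
     (\<forall>e\<in>edges G. p (Edge e) \<in> Vertex ` verts B \<union> Edge ` edges B) \<and>
     (\<forall>e\<in>edges G. \<forall>w. p (Edge e) = Vertex w \<longrightarrow> (\<forall>x\<in>e. p (Vertex x) = Vertex w)) \<and>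
     (\<forall>e\<in>edges G. \<forall>f. p (Edge e) = Edge f \<longrightarrow> (\<lambda>x. p (Vertex x)) ` e = Vertex ` f)"

definition vertex_fibre ::
  "('g graph_elem \<Rightarrow> 'b graph_elem) \<Rightarrow> 'g sgraph \<Rightarrow> 'b \<Rightarrow> 'g sgraph" where
  "vertex_fibre p G v =
     SGraph {x \<in> verts G. p (Vertex x) = Vertex v} {e \<in> edges G. p (Edge e) = Vertex v}"

text \<open>The preimage of an edge is taken to include the fibres over its two end vertices.\<close>

definition edge_fibre ::
  "('g graph_elem \<Rightarrow> 'b graph_elem) \<Rightarrow> 'g sgraph \<Rightarrow> 'b set \<Rightarrow> 'g sgraph" where
  "edge_fibre p G e =
     SGraph (\<Union>v\<in>e. verts (vertex_fibre p G v))
            ((\<Union>v\<in>e. edges (vertex_fibre p G v)) \<union> {d \<in> edges G. p (Edge d) = Edge e})"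

text \<open>The isomorphism from the preimage of an edge \<open>{u, v}\<close> to the product of \<open>F\<close> with \<open>K2\<close> carries
  the fibres over \<open>u\<close> and \<open>v\<close> to the two copies of \<open>F\<close>. Hence the edges mapped to \<open>{u, v}\<close>
  correspond to the edges joining the two copies, i.e. they form a perfect matching between the
  two fibres which induces an isomorphism between them.\<close>

definition cartesian_bundle :: "'g sgraph \<Rightarrow> 'f sgraph \<Rightarrow> 'b sgraph \<Rightarrow> bool" where
  "cartesian_bundle G F B \<longleftrightarrow>
     (\<exists>p. graph_map p G B \<and>
        (\<forall>v\<in>verts B. \<exists>f. graph_iso f (vertex_fibre p G v) F) \<and>
        (\<forall>u v. {u, v} \<in> edges B \<longrightarrow>
           (\<exists>f. graph_iso f (edge_fibre p G {u, v}) (cartesian_product F K2) \<and>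
                f ` verts (vertex_fibre p G u) = verts F \<times> {False} \<and>
                f ` verts (vertex_fibre p G v) = verts F \<times> {True})))"

end

theory Submission imports Defs begin

text \<open>Write \<open>r\<close> and \<open>s\<close> for the two fault diameters on the right-hand side. What has to be shown
  is that any \<open>x\<close> and \<open>y\<close> in \<open>G\<close> stay within distance \<open>r + s\<close> after the removal of a set \<open>X\<close> of at
  most \<open>a + b + 1\<close> edges. This also shows that \<open>G\<close> remains connected under so many faults, so that
  its fault diameter is a maximum and not \<open>\<infinity>\<close> by convention (lemma
  \<open>fault_tolerant_imp_edge_fault_diameter_le\<close>).

  Let \<open>x\<close> lie over \<open>v\<close> and \<open>y\<close> over \<open>w\<close>. A walk of the base can be lifted to \<open>G\<close> from any point
  over its start, and a route from \<open>x\<close> to \<open>y\<close> is pieced together from lifts of base walks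
  (cost at most \<open>s\<close>) and walks inside one fibre (cost at most \<open>r\<close>). If the fibre over \<open>v\<close> has at
  most \<open>a\<close> faults, then the case \<open>v = w\<close> is clear, and so is the case \<open>v \<noteq> w\<close> if the faults outside the
  fibres lie above at most \<open>b\<close> base edges, which can then be avoided: lift a base walk from
  \<open>y\<close> into the fibre of \<open>x\<close> and finish there. One fault too many can spoil this in two ways.

  \<^item> The fibre over \<open>v\<close> has more than \<open>a\<close> faults (\<open>reach_of_crowded_fibre\<close>). Then at most \<open>b\<close>
    faults are left, few enough to find a base walk which avoids them and whose first step leads to a
    fault-free fibre; the change from \<open>x\<close> to \<open>y\<close> is made in that fibre. For \<open>v = w\<close> this is a
    detour of two extra steps, affordable because \<open>s \<ge> 2\<close>.

  \<^item> The faults lie above more than \<open>b\<close> base edges, and \<open>v \<noteq> w\<close> (\<open>reach_of_sparse_faults\<close>).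
    Then a base walk is made to avoid \<open>b\<close> of these edges, and at most \<open>a + 1\<close> faults remain that matter. The lifts of
    the walk from the various points of the fibre over \<open>v\<close> are edge-disjoint
    (\<open>path_lifts\<close>), so each remaining fault spoils at most one of them. If the lifts at both \<open>x\<close> and
    \<open>y\<close> are spoiled, go one step from \<open>x\<close> to a point whose lift is intact, follow that lift, and
    complete the walk in the fibre over \<open>w\<close>; finding this first step only requires avoiding \<open>a\<close> edges
    of the fibre. For \<open>x\<close> and \<open>y\<close> on the same lift this is again a detour of two extra steps,
    affordable because \<open>r \<ge> 2\<close>.\<close>

section \<open>Walks of bounded length\<close>

text \<open>Distances are bounded through walks, since these can be concatenated and mapped without
  any care for repeated vertices.\<close>

inductive reach :: "'a sgraph \<Rightarrow> nat \<Rightarrow> 'a \<Rightarrow> 'a \<Rightarrow> bool" for H where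
  reach_refl: "reach H n x x"
| reach_step: "{x, z} \<in> edges H \<Longrightarrow> reach H n z y \<Longrightarrow> reach H (Suc n) x y"

lemma reach_mono:
  assumes "reach H m x y" and "m \<le> n" and "edges H \<subseteq> edges K"
  shows "reach K n x y"
  using assms
proof (induction arbitrary: n)
  case (reach_refl m x)
  show ?case by (rule reach.reach_refl)
next
  case (reach_step x z m y)
  then obtain n' where "n = Suc n'" "m \<le> n'" by (cases n) auto
  with reach_step show ?case by (auto intro: reach.reach_step)
qed

lemma reach_trans:
  assumes "reach H m x y" and "reach H n y z"
  shows "reach H (m + n) x z"
  using assms
proof (induction)
  case (reach_refl m x)
  then show ?case by (auto intro: reach_mono)
next
  case (reach_step x u m y)
  then show ?case by (auto intro: reach.reach_step)
qed

lemma reach_edge: "{x, y} \<in> edges H \<Longrightarrow> reach H 1 x y"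
  using reach_step[OF _ reach_refl[of H 0 y]] by simp

lemma reach_sym:
  assumes "reach H n x y"
  shows "reach H n y x"
  using assms
proof (induction)
  case (reach_refl n x)
  show ?case by (rule reach.reach_refl)
next
  case (reach_step x z n y)
  have "reach H 1 z x"
    using reach_step(1) by (intro reach_edge) (simp add: insert_commute)
  from reach_trans[OF reach_step(3) this] show ?case by simp
qed

lemma reach_first_step:
  assumes "reach H n x y" and "x \<noteq> y"
  obtains m z where "n = Suc m" "{x, z} \<in> edges H" "reach H m z y"
  using assms by (auto elim: reach.cases)

lemma is_path_Cons:
  "is_path H x (v # vs) y \<longleftrightarrow>
     v = x \<and> x \<in> verts H \<and>
     (vs = [] \<and> y = x \<or> vs \<noteq> [] \<and> x \<notin> set vs \<and> {x, hd vs} \<in> edges H \<and> is_path H (hd vs) vs y)"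
proof (cases vs)
  case Nil
  then show ?thesis by (auto simp: is_path_def)
next
  case (Cons v' vs')
  have "(\<forall>i. Suc i < length (v # vs) \<longrightarrow> {(v # vs) ! i, (v # vs) ! Suc i} \<in> edges H) \<longleftrightarrow>
        {v, v'} \<in> edges H \<and> (\<forall>i. Suc i < length vs \<longrightarrow> {vs ! i, vs ! Suc i} \<in> edges H)"
    unfolding Cons by (auto simp: nth_Cons split: nat.splits)
  then show ?thesis unfolding is_path_def using Cons by auto
qed

lemma is_path_imp_reach:
  assumes "is_path H x vs y"
  shows "reach H (length vs - 1) x y"
  using assms
proof (induction vs arbitrary: x)
  case Nil
  then show ?case by (simp add: is_path_def)
next
  case (Cons v vs)
  show ?case
  proof (cases "vs = []")
    case True
    then show ?thesis using Cons.prems by (auto simp: is_path_Cons intro: reach_refl)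
  next
    case False
    then have "{x, hd vs} \<in> edges H" "reach H (length vs - 1) (hd vs) y"
      using Cons by (auto simp: is_path_Cons)
    then show ?thesis using False reach_step by (cases vs) fastforce+
  qed
qed

lemma is_path_suffix:
  assumes "is_path H x vs y" and "z \<in> set vs"
  obtains us where "is_path H z us y" "length us \<le> length vs"
  using assms
proof (induction vs arbitrary: x thesis)
  case Nil
  then show ?case by simp
next
  case (Cons v vs)
  show ?case
  proof (cases "z = v")
    case True
    with Cons.prems(2) have "is_path H z (v # vs) y" by (simp add: is_path_Cons)
    then show ?thesis using Cons.prems(1) by blast
  next
    case False
    with Cons.prems have "z \<in> set vs" "is_path H (hd vs) vs y"
      by (auto simp: is_path_Cons)
    then obtain us where "is_path H z us y" "length us \<le> length vs"
      using Cons.IH by blast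
    then show ?thesis using Cons.prems(1)[of us] by simp
  qed
qed

text \<open>A vertex that a walk revisits is shortcut: the path already built from the second vertex on
  is cut down to its part after the revisited vertex.\<close>

lemma reach_imp_is_path:
  assumes "reach H n x y" and "y \<in> verts H" and "\<forall>e\<in>edges H. e \<subseteq> verts H"
  obtains vs where "is_path H x vs y" "length vs \<le> Suc n"
  using assms
proof (induction arbitrary: thesis)
  case (reach_refl n x)
  then show ?case using reach_refl(1)[of "[x]"] by (auto simp: is_path_Cons)
next
  case (reach_step x z n y)
  obtain vs where vs: "is_path H z vs y" "length vs \<le> Suc n"
    using reach_step by blast
  show ?case
  proof (cases "x \<in> set vs")
    case True
    then obtain us where "is_path H x us y" "length us \<le> length vs"
      using is_path_suffix vs by metis
    then show ?thesis using reach_step(4)[of us] vs by simp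
  next
    case False
    have "x \<in> verts H" using reach_step by auto
    moreover have "vs \<noteq> []" "hd vs = z" using vs by (auto simp: is_path_def)
    ultimately have "is_path H x (x # vs) y"
      using False vs reach_step(1) by (simp add: is_path_Cons)
    then show ?thesis using reach_step(4)[of "x # vs"] vs by simp
  qed
qed

lemma graph_dist_le_iff:
  assumes "y \<in> verts H" and "\<forall>e\<in>edges H. e \<subseteq> verts H"
  shows "graph_dist H x y \<le> enat n \<longleftrightarrow> reach H n x y"
proof
  assume "graph_dist H x y \<le> enat n"
  then have "graph_dist H x y < enat (Suc n)"
    by (metis enat_ord_simps(2) le_less_trans lessI)
  then obtain vs where "is_path H x vs y" "length vs - 1 < Suc n"
    by (auto simp: graph_dist_def INF_less_iff)
  then show "reach H n x y"
    using reach_mono[OF is_path_imp_reach] by fastforce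
next
  assume "reach H n x y"
  then obtain vs where vs: "is_path H x vs y" "length vs \<le> Suc n"
    using reach_imp_is_path assms by metis
  then have "graph_dist H x y \<le> enat (length vs - 1)"
    unfolding graph_dist_def by (intro INF_lower) simp
  also have "\<dots> \<le> enat n" using vs by simp
  finally show "graph_dist H x y \<le> enat n" .
qed

section \<open>Fault tolerance and the edge fault diameter\<close>

text \<open>For a graph with at least two vertices, this is the condition \<open>\<D>\<^sup>E\<^sub>a(H) \<le> r\<close>, phrased
  for all sets of at most \<open>a\<close> faults. A fault need not be an edge of \<open>H\<close>, so the faults of a
  bundle can be handed to a fibre or to the base as they are.\<close>

definition fault_tolerant :: "nat \<Rightarrow> nat \<Rightarrow> 'a sgraph \<Rightarrow> bool" where
  "fault_tolerant a r H \<longleftrightarrow>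
     (\<forall>Y. finite Y \<longrightarrow> card Y \<le> a \<longrightarrow>
        (\<forall>x\<in>verts H. \<forall>y\<in>verts H. reach (delete_edges H Y) r x y))"

lemma fault_tolerantD:
  assumes "fault_tolerant a r H" "finite Y" "card Y \<le> a" "x \<in> verts H" "y \<in> verts H"
  shows "reach (delete_edges H Y) r x y"
  using assms by (simp add: fault_tolerant_def)

lemma verts_delete_edges [simp]: "verts (delete_edges H X) = verts H"
  and edges_delete_edges [simp]: "edges (delete_edges H X) = edges H - X"
  by (simp_all add: delete_edges_def)

lemma simple_graph_no_loop:
  assumes "simple_graph H" and "{x, y} \<in> edges H"
  shows "x \<noteq> y"
proof -
  have "card {x, y} = 2" using assms unfolding simple_graph_def by blast
  then show ?thesis by auto
qed

lemma simple_graph_finite_edges: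
  assumes "simple_graph H"
  shows "finite (edges H)"
proof (rule finite_subset)
  show "edges H \<subseteq> Pow (verts H)" using assms by (auto simp: simple_graph_def)
  show "finite (Pow (verts H))" using assms by (simp add: simple_graph_def)
qed

lemma delete_all_edges_disconnects: "\<not> graph_connected (delete_edges H (edges H))"
proof
  assume *: "graph_connected (delete_edges H (edges H))"
  then have "1 < card (verts H)" by (simp add: graph_connected_def)
  then obtain x y where xy: "x \<in> verts H" "y \<in> verts H" "x \<noteq> y"
    by (metis card_le_Suc0_iff_eq card.infinite One_nat_def not_less not_less_zero)
  then obtain vs where "is_path (delete_edges H (edges H)) x vs y"
    using * by (auto simp: graph_connected_def)
  from is_path_imp_reach[OF this] xy show False by (auto elim: reach.cases)
qed

lemma edge_connectivity_le_card_edges: "edge_connectivity H \<le> card (edges H)"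
  unfolding edge_connectivity_def
  by (rule Least_le) (use delete_all_edges_disconnects in blast)

lemma finite_graph_dists:
  assumes "finite (verts H)"
  shows "finite {graph_dist H x y | x y. x \<in> verts H \<and> y \<in> verts H}"
  by (rule finite_image_set2) (use assms in simp_all)

lemma finite_fault_diameters:
  assumes "finite (edges H)"
  shows "finite {diameter (delete_edges H X) | X. X \<subseteq> edges H \<and> card X = a}"
proof (rule finite_subset)
  show "{diameter (delete_edges H X) | X. X \<subseteq> edges H \<and> card X = a}
      \<subseteq> (\<lambda>X. diameter (delete_edges H X)) ` Pow (edges H)" by auto
qed (use assms in simp)

text \<open>The fault diameter concerns sets of exactly \<open>a\<close> faults, but a smaller set can be enlarged,
  since \<open>a < \<lambda>(H) \<le> |E(H)|\<close>, and enlarging it only increases distances.\<close>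

lemma edge_fault_diameter_imp_fault_tolerant:
  fixes H :: "'a sgraph"
  assumes H: "simple_graph H" and diam: "edge_fault_diameter a H = enat r"
  shows "fault_tolerant a r H"
  unfolding fault_tolerant_def
proof (intro allI impI ballI)
  fix Y :: "'a set set" and x y :: 'a
  assume Y: "finite Y" "card Y \<le> a" and xy: "x \<in> verts H" "y \<in> verts H"
  have fin: "finite (edges H)" "finite (verts H)"
    using H simple_graph_finite_edges by (auto simp: simple_graph_def)
  have a: "a < edge_connectivity H"
    using diam by (auto simp: edge_fault_diameter_def split: if_splits)
  have "card (Y \<inter> edges H) \<le> card Y"
    using Y by (intro card_mono) auto
  then have "card (Y \<inter> edges H) \<le> a" using Y by linarith
  moreover have "a \<le> card (edges H)"
    using a edge_connectivity_le_card_edges[of H] by linarith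
  ultimately obtain X where X: "Y \<inter> edges H \<subseteq> X" "X \<subseteq> edges H" "card X = a"
    using exists_subset_between[of "Y \<inter> edges H" a "edges H"] fin by auto
  let ?K = "delete_edges H X"
  have "graph_dist ?K x y \<le> diameter ?K"
    unfolding diameter_def using xy fin by (intro Max_ge finite_graph_dists) auto
  also have "\<dots> \<le> Max {diameter (delete_edges H X) | X. X \<subseteq> edges H \<and> card X = a}"
    using X fin by (intro Max_ge finite_fault_diameters) auto
  also have "\<dots> = enat r" using diam a by (simp add: edge_fault_diameter_def)
  finally have "reach ?K r x y"
    using xy H by (subst (asm) graph_dist_le_iff) (auto simp: simple_graph_def)
  then show "reach (delete_edges H Y) r x y"
    by (rule reach_mono) (use X in auto)
qed

text \<open>Bounded distances include connectedness, whence \<open>m < \<lambda>(H)\<close>. In particular \<open>H\<close> has at least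
  \<open>m\<close> edges and the maximum ranges over a nonempty set.\<close>

lemma fault_tolerant_imp_edge_fault_diameter_le:
  assumes H: "simple_graph H" and "1 < card (verts H)" and ft: "fault_tolerant m r H"
  shows "edge_fault_diameter m H \<le> enat r"
proof -
  have fin: "finite (edges H)" "finite (verts H)"
    using H simple_graph_finite_edges by (auto simp: simple_graph_def)
  have *: "reach (delete_edges H X) r x y"
    if "X \<subseteq> edges H" "card X \<le> m" "x \<in> verts H" "y \<in> verts H" for X x y
    using ft that finite_subset[OF that(1) fin(1)] by (auto simp: fault_tolerant_def)
  have sub: "\<forall>e\<in>edges (delete_edges H X). e \<subseteq> verts (delete_edges H X)" for X
    using H by (auto simp: simple_graph_def)
  have connected: "graph_connected (delete_edges H X)" if "X \<subseteq> edges H" "card X \<le> m" for X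
    unfolding graph_connected_def
    using *[OF that] reach_imp_is_path[OF _ _ sub] assms(2) by (metis verts_delete_edges)
  let ?P = "\<lambda>n. \<exists>X\<subseteq>edges H. card X = n \<and> \<not> graph_connected (delete_edges H X)"
  have "?P (edge_connectivity H)"
    unfolding edge_connectivity_def
    by (rule LeastI[of ?P "card (edges H)"]) (use delete_all_edges_disconnects in blast)
  then have m: "m < edge_connectivity H"
    using connected by (metis not_less)
  then have "m \<le> card (edges H)"
    using edge_connectivity_le_card_edges[of H] by linarith
  then obtain X0 where X0: "X0 \<subseteq> edges H" "card X0 = m"
    by (metis obtain_subset_with_card_n)
  have "diameter (delete_edges H X) \<le> enat r" if X: "X \<subseteq> edges H" "card X = m" for X
  proof -
    have "graph_dist (delete_edges H X) x y \<le> enat r" if "x \<in> verts H" "y \<in> verts H" for x y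
      using *[of X x y] X that by (subst graph_dist_le_iff[OF _ sub]) auto
    moreover obtain z where "z \<in> verts H" using assms(2) by fastforce
    ultimately show ?thesis
      unfolding diameter_def using fin
      by (intro Max.boundedI) (use finite_graph_dists[of "delete_edges H X"] in auto)
  qed
  then have "Max {diameter (delete_edges H X) | X. X \<subseteq> edges H \<and> card X = m} \<le> enat r"
    using X0 by (subst Max_le_iff) (auto simp: finite_fault_diameters[OF fin(1)])
  then show ?thesis using m by (simp add: edge_fault_diameter_def)
qed

section \<open>Isomorphisms\<close>

lemma graph_iso_sym:
  assumes "graph_iso f H K"
  shows "graph_iso (inv_into (verts H) f) K H"
proof -
  have bij: "bij_betw f (verts H) (verts K)" using assms by (simp add: graph_iso_def)
  have "{x, y} \<in> edges K \<longleftrightarrow>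
      {inv_into (verts H) f x, inv_into (verts H) f y} \<in> edges H"
    if "x \<in> verts K" "y \<in> verts K" for x y
    using assms that bij_betw_inv_into_right[OF bij] bij_betw_apply[OF bij_betw_inv_into[OF bij]]
    by (simp add: graph_iso_def)
  then show ?thesis using bij_betw_inv_into[OF bij] by (simp add: graph_iso_def)
qed

lemma graph_iso_trans:
  assumes "graph_iso f H K" and "graph_iso g K L"
  shows "graph_iso (g \<circ> f) H L"
  using assms by (auto simp: graph_iso_def bij_betw_trans bij_betw_apply)

lemma graph_iso_id: "graph_iso id H H"
  by (simp add: graph_iso_def)

text \<open>A walk that avoids the faults pulled back along an isomorphism is mapped to a walk that
  avoids the faults themselves. The set \<open>Z\<close> leaves room for avoiding further edges.\<close>

lemma graph_iso_reach:
  assumes f: "graph_iso f H K" and H: "\<forall>e\<in>edges H. e \<subseteq> verts H"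
    and Z: "image (inv_into (verts H) f) ` Y \<subseteq> Z"
    and "reach (delete_edges H Z) n x y"
  shows "reach (delete_edges K Y) n (f x) (f y)"
  using assms(4)
proof (induction)
  case (reach_refl n x)
  show ?case by (rule reach.reach_refl)
next
  case (reach_step x z n y)
  have xz: "x \<in> verts H" "z \<in> verts H" "{x, z} \<in> edges H" "{x, z} \<notin> Z"
    using reach_step(1) H by auto
  have bij: "bij_betw f (verts H) (verts K)" using f by (simp add: graph_iso_def)
  have "inv_into (verts H) f ` {f x, f z} = {x, z}"
    using bij_betw_inv_into_left[OF bij] xz by simp
  then have "{f x, f z} \<notin> Y" using Z xz by (metis image_eqI subsetD)
  then show ?case
    using f xz reach_step(3) by (intro reach.reach_step) (auto simp: graph_iso_def)
qed

lemma fault_tolerant_graph_iso: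
  fixes H :: "'a sgraph" and K :: "'b sgraph"
  assumes f: "graph_iso f H K" and H: "\<forall>e\<in>edges H. e \<subseteq> verts H" and "fault_tolerant a r H"
  shows "fault_tolerant a r K"
  unfolding fault_tolerant_def
proof (intro allI impI ballI)
  fix Y :: "'b set set" and x y :: 'b
  assume Y: "finite Y" "card Y \<le> a" and xy: "x \<in> verts K" "y \<in> verts K"
  have "verts K = f ` verts H" using f by (simp add: graph_iso_def bij_betw_def)
  with xy obtain s t where st: "s \<in> verts H" "t \<in> verts H" "x = f s" "y = f t"
    by blast
  let ?Z = "image (inv_into (verts H) f) ` Y"
  have "card ?Z \<le> a" by (rule le_trans[OF card_image_le[OF Y(1)] Y(2)])
  then have "reach (delete_edges H ?Z) r s t"
    using assms(3) Y st by (intro fault_tolerantD) auto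
  then show "reach (delete_edges K Y) r x y"
    unfolding st by (rule graph_iso_reach[OF f H subset_refl])
qed

section \<open>Fibres of a bundle and lifts of base paths\<close>

locale graph_bundle =
  fixes F :: "'f sgraph" and B :: "'b sgraph" and G :: "'g sgraph"
    and p :: "'g graph_elem \<Rightarrow> 'b graph_elem"
  assumes simple_F: "simple_graph F" and simple_B: "simple_graph B" and simple_G: "simple_graph G"
    and graph_map_p: "graph_map p G B"
    and vertex_fibre_iso: "v \<in> verts B \<Longrightarrow> \<exists>f. graph_iso f (vertex_fibre p G v) F"
    and edge_fibre_iso: "{u, v} \<in> edges B \<Longrightarrow>
           (\<exists>f. graph_iso f (edge_fibre p G {u, v}) (cartesian_product F K2) \<and>
                f ` verts (vertex_fibre p G u) = verts F \<times> {False} \<and>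
                f ` verts (vertex_fibre p G v) = verts F \<times> {True})"
begin

abbreviation fibre :: "'b \<Rightarrow> 'g sgraph" where
  "fibre \<equiv> vertex_fibre p G"

lemma in_verts_fibre: "x \<in> verts (fibre v) \<longleftrightarrow> x \<in> verts G \<and> p (Vertex x) = Vertex v"
  by (simp add: vertex_fibre_def)

lemma in_edges_fibre: "e \<in> edges (fibre v) \<longleftrightarrow> e \<in> edges G \<and> p (Edge e) = Vertex v"
  by (simp add: vertex_fibre_def)

lemma finite_verts_fibre: "finite (verts (fibre v))"
  using simple_G by (simp add: vertex_fibre_def simple_graph_def)

lemma fibre_edge_subset: "\<forall>e\<in>edges (fibre v). e \<subseteq> verts (fibre v)"
  using graph_map_p simple_G
  by (auto simp: graph_map_def simple_graph_def in_edges_fibre in_verts_fibre) blast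

lemma fault_tolerant_fibre:
  assumes "fault_tolerant a r F" and "v \<in> verts B"
  shows "fault_tolerant a r (fibre v)"
proof -
  obtain f where "graph_iso f (fibre v) F" using vertex_fibre_iso assms by blast
  from graph_iso_sym[OF this] show ?thesis
    by (rule fault_tolerant_graph_iso) (use assms simple_F in \<open>auto simp: simple_graph_def\<close>)
qed

lemma reach_fibre_imp_reach:
  assumes "reach (delete_edges (fibre v) Y) n x y"
    and "{e \<in> X. p (Edge e) = Vertex v} \<subseteq> Y"
  shows "reach (delete_edges G X) n x y"
  using assms by (elim reach_mono) (auto simp: in_edges_fibre)

text \<open>Both fibres are identified with \<open>F\<close> through the first coordinate of the isomorphism of the
  edge fibre with \<open>F \<box> K2\<close>; the matching joins the points with the same first coordinate.\<close>

lemma fibre_matching: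
  assumes uv: "{u, v} \<in> edges B"
  obtains \<phi> where "graph_iso \<phi> (fibre u) (fibre v)"
    "\<And>z. z \<in> verts (fibre u) \<Longrightarrow> {z, \<phi> z} \<in> edges G \<and> p (Edge {z, \<phi> z}) = Edge {u, v}"
proof -
  have neq: "u \<noteq> v" by (rule simple_graph_no_loop[OF simple_B uv])
  obtain f where f: "graph_iso f (edge_fibre p G {u, v}) (cartesian_product F K2)"
    and fu: "f ` verts (fibre u) = verts F \<times> {False}"
    and fv: "f ` verts (fibre v) = verts F \<times> {True}"
    using edge_fibre_iso[OF uv] by blast
  have V: "verts (edge_fibre p G {u, v}) = verts (fibre u) \<union> verts (fibre v)"
    by (auto simp: edge_fibre_def)
  have inj: "inj_on f (verts (fibre u) \<union> verts (fibre v))"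
    using f V by (simp add: graph_iso_def bij_betw_def)
  have edge_f: "{x, y} \<in> edges (edge_fibre p G {u, v}) \<longleftrightarrow>
      {f x, f y} \<in> edges (cartesian_product F K2)"
    if "x \<in> verts (fibre u) \<union> verts (fibre v)" "y \<in> verts (fibre u) \<union> verts (fibre v)" for x y
    using f that V by (simp add: graph_iso_def)
  have ends: "(\<lambda>x. p (Vertex x)) ` e = Vertex ` {u, v}"
    if "e \<in> edges G" "p (Edge e) = Edge {u, v}" for e
    using graph_map_p that by (simp add: graph_map_def)
  have inner: "{x, y} \<in> edges (edge_fibre p G {u, v}) \<longleftrightarrow> {x, y} \<in> edges (fibre w)"
    if w: "w \<in> {u, v}" and xy: "x \<in> verts (fibre w)" "y \<in> verts (fibre w)" for x y w
  proof
    assume "{x, y} \<in> edges (edge_fibre p G {u, v})"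
    then consider w' where "w' \<in> {u, v}" "{x, y} \<in> edges (fibre w')"
      | "{x, y} \<in> edges G" "p (Edge {x, y}) = Edge {u, v}"
      by (auto simp: edge_fibre_def)
    then show "{x, y} \<in> edges (fibre w)"
    proof cases
      case 1
      then have "x \<in> verts (fibre w')" using fibre_edge_subset by blast
      then have "w' = w" using xy by (simp add: in_verts_fibre)
      then show ?thesis using 1 by simp
    next
      case 2
      then show ?thesis using ends[OF 2] xy neq by (auto simp: in_verts_fibre)
    qed
  qed (use w in \<open>auto simp: edge_fibre_def\<close>)
  have iso: "graph_iso (fst \<circ> f) (fibre w) F"
    if w: "w \<in> {u, v}" and fw: "f ` verts (fibre w) = verts F \<times> {c}" for w c
  proof -
    have "inj_on f (verts (fibre w))" using inj w by (auto intro: inj_on_subset)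
    then have "bij_betw f (verts (fibre w)) (verts F \<times> {c})" using fw by (simp add: bij_betw_def)
    moreover have "bij_betw fst (verts F \<times> {c}) (verts F)"
      by (auto simp: bij_betw_def inj_on_def)
    ultimately have "bij_betw (fst \<circ> f) (verts (fibre w)) (verts F)" by (rule bij_betw_trans)
    moreover have "{x, y} \<in> edges (fibre w) \<longleftrightarrow> {fst (f x), fst (f y)} \<in> edges F"
      if xy: "x \<in> verts (fibre w)" "y \<in> verts (fibre w)" for x y
    proof -
      obtain s t where st: "s \<in> verts F" "t \<in> verts F" "f x = (s, c)" "f y = (t, c)"
        using fw xy by (metis (no_types, lifting) SigmaE image_eqI singletonD)
      have "{x, y} \<in> edges (fibre w) \<longleftrightarrow> {f x, f y} \<in> edges (cartesian_product F K2)"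
        using inner[OF w xy] edge_f[of x y] w xy by auto
      also have "\<dots> \<longleftrightarrow> {s, t} \<in> edges F"
        unfolding st
        by (auto simp: cartesian_product_def K2_def doubleton_eq_iff insert_commute)
      finally show ?thesis using st by simp
    qed
    ultimately show ?thesis by (simp add: graph_iso_def)
  qed
  define \<phi> where "\<phi> = inv_into (verts (fibre v)) (fst \<circ> f) \<circ> (fst \<circ> f)"
  have iso_u: "graph_iso (fst \<circ> f) (fibre u) F" and iso_v: "graph_iso (fst \<circ> f) (fibre v) F"
    using iso[OF _ fu] iso[OF _ fv] by auto
  have iso_\<phi>: "graph_iso \<phi> (fibre u) (fibre v)"
    unfolding \<phi>_def by (rule graph_iso_trans[OF iso_u graph_iso_sym[OF iso_v]])
  show thesis
  proof (rule that[OF iso_\<phi>])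
    fix z assume z: "z \<in> verts (fibre u)"
    have \<phi>z: "\<phi> z \<in> verts (fibre v)"
      using iso_\<phi> z by (auto simp: graph_iso_def bij_betw_apply)
    have s: "fst (f z) \<in> verts F" using iso_u z by (auto simp: graph_iso_def dest: bij_betw_apply)
    have "fst (f (\<phi> z)) = fst (f z)"
      using bij_betw_inv_into_right[of "fst \<circ> f" "verts (fibre v)" "verts F" "fst (f z)"] iso_v s
      by (simp add: \<phi>_def graph_iso_def)
    moreover have "snd (f (\<phi> z)) = True" "snd (f z) = False"
      using fu fv z \<phi>z by (metis (no_types, lifting) SigmaE image_eqI singletonD snd_conv)+
    ultimately have eq: "f z = (fst (f z), False)" "f (\<phi> z) = (fst (f z), True)"
      by (simp_all add: prod_eq_iff)
    have "{f z, f (\<phi> z)} \<in> edges (cartesian_product F K2)"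
      unfolding cartesian_product_def K2_def using s
      by (subst eq(1), subst eq(2)) auto
    then have "{z, \<phi> z} \<in> edges (edge_fibre p G {u, v})"
      using edge_f[of z "\<phi> z"] z \<phi>z by auto
    moreover have "{z, \<phi> z} \<notin> edges (fibre w)" for w
      using fibre_edge_subset[of w] z \<phi>z neq by (auto simp: in_verts_fibre)
    ultimately show "{z, \<phi> z} \<in> edges G \<and> p (Edge {z, \<phi> z}) = Edge {u, v}"
      by (auto simp: edge_fibre_def)
  qed
qed

text \<open>A base path carries one lift from each point of its first fibre, obtained by following the
  matchings. These lifts are pairwise edge-disjoint, because the path does not repeat a base edge.
  So every fault above the path spoils at most one lift.\<close>

lemma path_lifts:
  assumes "finite X" and "is_path (delete_edges B Y) u vs w"
  obtains T where "graph_iso T (fibre u) (fibre w)"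
    "card {z \<in> verts (fibre u). \<not> reach (delete_edges G X) (length vs - 1) z (T z)}
      \<le> card {e \<in> X. \<exists>f. p (Edge e) = Edge f \<and> f \<notin> Y \<and> f \<subseteq> set vs}"
  using assms(2)
proof (induction vs arbitrary: u thesis)
  case Nil
  then show ?case by (simp add: is_path_def)
next
  case (Cons v vs)
  have [simp]: "v = u" using Cons.prems(2) by (simp add: is_path_Cons)
  show ?case
  proof (cases "vs = []")
    case True
    then have "w = u" using Cons.prems(2) by (simp add: is_path_Cons)
    show ?thesis
    proof (intro Cons.prems(1)[of id])
      show "graph_iso id (fibre u) (fibre w)" using \<open>w = u\<close> graph_iso_id by simp
    qed (use True \<open>w = u\<close> in \<open>simp add: reach_refl\<close>)
  next
    case False
    define u' where "u' = hd vs"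
    have u': "u \<notin> set vs" "{u, u'} \<in> edges B" "{u, u'} \<notin> Y"
      "is_path (delete_edges B Y) u' vs w" "u' \<in> set vs"
      using Cons.prems(2) False by (auto simp: is_path_Cons u'_def)
    obtain T where T: "graph_iso T (fibre u') (fibre w)"
      and cardT: "card {z \<in> verts (fibre u'). \<not> reach (delete_edges G X) (length vs - 1) z (T z)}
        \<le> card {e \<in> X. \<exists>f. p (Edge e) = Edge f \<and> f \<notin> Y \<and> f \<subseteq> set vs}"
      (is "card ?bad' \<le> card ?tail")
      using Cons.IH u'(4) by blast
    obtain \<phi> where \<phi>: "graph_iso \<phi> (fibre u) (fibre u')"
      and match: "\<And>z. z \<in> verts (fibre u) \<Longrightarrow>
        {z, \<phi> z} \<in> edges G \<and> p (Edge {z, \<phi> z}) = Edge {u, u'}"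
      using fibre_matching[OF u'(2)] by blast
    have \<phi>_in: "\<phi> z \<in> verts (fibre u')" if "z \<in> verts (fibre u)" for z
      using \<phi> that by (auto simp: graph_iso_def bij_betw_apply)
    have \<phi>_inj: "inj_on \<phi> (verts (fibre u))"
      using \<phi> by (auto simp: graph_iso_def bij_betw_def)
    let ?bad = "{z \<in> verts (fibre u).
      \<not> reach (delete_edges G X) (length (v # vs) - 1) z ((T \<circ> \<phi>) z)}"
    let ?cut = "{z \<in> verts (fibre u). {z, \<phi> z} \<in> X}"
    let ?rest = "{z \<in> verts (fibre u). \<phi> z \<in> ?bad'}"
    let ?head = "{e \<in> X. p (Edge e) = Edge {u, u'}}"
    have "?bad \<subseteq> ?cut \<union> ?rest"
    proof
      fix z assume z: "z \<in> ?bad"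
      show "z \<in> ?cut \<union> ?rest"
      proof (rule ccontr)
        assume "z \<notin> ?cut \<union> ?rest"
        then have "{z, \<phi> z} \<in> edges (delete_edges G X)"
          "reach (delete_edges G X) (length vs - 1) (\<phi> z) (T (\<phi> z))"
          using z match \<phi>_in by auto
        then have "reach (delete_edges G X) (Suc (length vs - 1)) z (T (\<phi> z))"
          by (rule reach_step)
        then show False using z False by simp
      qed
    qed
    then have "card ?bad \<le> card (?cut \<union> ?rest)"
      by (intro card_mono) (simp_all add: finite_verts_fibre)
    also have "\<dots> \<le> card ?cut + card ?rest" by (rule card_Un_le)
    also have "card ?cut \<le> card ?head"
    proof (rule card_inj_on_le)
      show "inj_on (\<lambda>z. {z, \<phi> z}) ?cut"
      proof (rule inj_onI)
        fix x y assume xy: "x \<in> ?cut" "y \<in> ?cut" "{x, \<phi> x} = {y, \<phi> y}"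
        have "p (Vertex x) = Vertex u" "p (Vertex (\<phi> y)) = Vertex u'"
          using xy \<phi>_in by (auto simp: in_verts_fibre)
        moreover have "u \<noteq> u'" using u' by auto
        ultimately have "x \<noteq> \<phi> y" by auto
        then show "x = y" using xy(3) by (auto simp: doubleton_eq_iff)
      qed
    qed (use match assms(1) in auto)
    also have "card ?rest \<le> card ?bad'"
      by (rule card_inj_on_le[of \<phi>])
        (auto intro: inj_on_subset[OF \<phi>_inj] simp: finite_verts_fibre)
    also note cardT
    also have "card ?head + card ?tail = card (?head \<union> ?tail)"
      using u' assms(1) by (intro card_Un_disjoint[symmetric]) auto
    also have "\<dots> \<le> card {e \<in> X. \<exists>f. p (Edge e) = Edge f \<and> f \<notin> Y \<and> f \<subseteq> set (v # vs)}"
      using u' assms(1) by (intro card_mono) auto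
    finally show ?thesis
      using Cons.prems(1)[OF graph_iso_trans[OF \<phi> T]] by simp
  qed
qed

lemma walk_lifts:
  assumes "finite X" and "reach (delete_edges B Y) n u w" and "w \<in> verts B"
  obtains T where "graph_iso T (fibre u) (fibre w)"
    "card {z \<in> verts (fibre u). \<not> reach (delete_edges G X) n z (T z)}
      \<le> card {e \<in> X. \<exists>f. p (Edge e) = Edge f \<and> f \<notin> Y}"
proof -
  obtain vs where vs: "is_path (delete_edges B Y) u vs w" "length vs \<le> Suc n"
    using reach_imp_is_path[OF assms(2)] assms(3) simple_B
    by (metis DiffD1 edges_delete_edges simple_graph_def verts_delete_edges)
  obtain T where T: "graph_iso T (fibre u) (fibre w)"
    and card: "card {z \<in> verts (fibre u). \<not> reach (delete_edges G X) (length vs - 1) z (T z)}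
      \<le> card {e \<in> X. \<exists>f. p (Edge e) = Edge f \<and> f \<notin> Y \<and> f \<subseteq> set vs}"
    using path_lifts[OF assms(1) vs(1)] by blast
  have "card {z \<in> verts (fibre u). \<not> reach (delete_edges G X) n z (T z)}
      \<le> card {z \<in> verts (fibre u). \<not> reach (delete_edges G X) (length vs - 1) z (T z)}"
  proof (rule card_mono)
    have "reach (delete_edges G X) n z z'" if "reach (delete_edges G X) (length vs - 1) z z'" for z z'
      by (rule reach_mono[OF that]) (use vs(2) in auto)
    then show "{z \<in> verts (fibre u). \<not> reach (delete_edges G X) n z (T z)}
        \<subseteq> {z \<in> verts (fibre u). \<not> reach (delete_edges G X) (length vs - 1) z (T z)}" by blast
  qed (simp add: finite_verts_fibre)
  also note card
  also have "card {e \<in> X. \<exists>f. p (Edge e) = Edge f \<and> f \<notin> Y \<and> f \<subseteq> set vs}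
      \<le> card {e \<in> X. \<exists>f. p (Edge e) = Edge f \<and> f \<notin> Y}"
    using assms(1) by (intro card_mono) auto
  finally show thesis using that T by blast
qed

lemma fault_free_lift:
  assumes "finite X" and "reach (delete_edges B Y) n u w" and "w \<in> verts B"
    and "\<forall>e\<in>X. \<forall>f. p (Edge e) = Edge f \<longrightarrow> f \<in> Y"
    and x: "x \<in> verts (fibre u)"
  obtains x' where "x' \<in> verts (fibre w)" "reach (delete_edges G X) n x x'"
proof -
  obtain T where T: "graph_iso T (fibre u) (fibre w)"
    and card: "card {z \<in> verts (fibre u). \<not> reach (delete_edges G X) n z (T z)}
      \<le> card {e \<in> X. \<exists>f. p (Edge e) = Edge f \<and> f \<notin> Y}"
    using walk_lifts[OF assms(1-3)] by blast
  have none: "{e \<in> X. \<exists>f. p (Edge e) = Edge f \<and> f \<notin> Y} = {}" using assms(4) by blast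
  have "{z \<in> verts (fibre u). \<not> reach (delete_edges G X) n z (T z)} = {}"
    using card unfolding none by (simp add: finite_verts_fibre)
  then have "reach (delete_edges G X) n x (T x)" using x by blast
  moreover have "T x \<in> verts (fibre w)"
    using T x by (auto simp: graph_iso_def bij_betw_apply)
  ultimately show thesis using that by blast
qed

section \<open>Fault tolerance of a bundle\<close>

text \<open>Every fault outside the fibre over \<open>v\<close> is charged to one pair of base vertices: a fault
  above a base edge to that edge, and a fault in the fibre over \<open>u\<close> to the pair \<open>{v, u}\<close>. A base
  walk from \<open>v\<close> that avoids the charged pairs meets no fault above its edges, and its first
  step ends below a fault-free fibre.\<close>

lemma reach_of_crowded_fibre:
  assumes F: "fault_tolerant a r F" and B: "fault_tolerant b s B"
    and "2 \<le> s" and "1 < card (verts B)" and X: "finite X"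
    and v: "v \<in> verts B" and w: "w \<in> verts B"
    and x: "x \<in> verts (fibre v)" and y: "y \<in> verts (fibre w)"
    and few: "card {e \<in> X. p (Edge e) \<noteq> Vertex v} \<le> b"
  shows "reach (delete_edges G X) (r + s) x y"
proof -
  define pr where "pr e = (case p (Edge e) of Edge f \<Rightarrow> f | Vertex u \<Rightarrow> {v, u})" for e
  define Y where "Y = pr ` {e \<in> X. p (Edge e) \<noteq> Vertex v}"
  have Y: "finite Y" "card Y \<le> b"
    using X few card_image_le[of "{e \<in> X. p (Edge e) \<noteq> Vertex v}" pr]
    by (auto simp: Y_def)
  have no_edge_fault: "\<forall>e\<in>X. \<forall>f. p (Edge e) = Edge f \<longrightarrow> f \<in> Y"
    by (force simp: Y_def pr_def)
  have no_fibre_fault: "{e \<in> X. p (Edge e) = Vertex u} = {}"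
    if "{v, u} \<in> edges (delete_edges B Y)" for u
  proof -
    have "u \<noteq> v" using that simple_graph_no_loop[OF simple_B] by force
    then have "{v, u} \<in> Y" if "e \<in> X" "p (Edge e) = Vertex u" for e
      using that by (force simp: Y_def pr_def)
    then show ?thesis using that by auto
  qed
  \<comment> \<open>Step from \<open>x\<close> over to the fault-free fibre, cross it, and follow the lift that ends in \<open>y\<close>.\<close>
  have through: "reach (delete_edges G X) (1 + r + m) x y"
    if vu: "{v, u} \<in> edges (delete_edges B Y)" and uw: "reach (delete_edges B Y) m u w" for u m
  proof -
    have u: "u \<in> verts B" using vu simple_B by (auto simp: simple_graph_def)
    obtain x' where x': "x' \<in> verts (fibre u)" "reach (delete_edges G X) 1 x x'"
      using fault_free_lift[OF X reach_edge[OF vu] u no_edge_fault x] by blast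
    obtain y' where y': "y' \<in> verts (fibre u)" "reach (delete_edges G X) m y y'"
      using fault_free_lift[OF X reach_sym[OF uw] u no_edge_fault y] by blast
    have "reach (delete_edges (fibre u) {}) r x' y'"
      using fault_tolerantD[OF fault_tolerant_fibre[OF F u]] x' y' by simp
    then have "reach (delete_edges G X) r x' y'"
      by (rule reach_fibre_imp_reach) (use no_fibre_fault[OF vu] in simp)
    from reach_trans[OF reach_trans[OF x'(2) this] reach_sym[OF y'(2)]] show ?thesis .
  qed
  show ?thesis
  proof (cases "v = w")
    case False
    have "reach (delete_edges B Y) s v w"
      using B Y v w by (intro fault_tolerantD)
    then obtain m u where "s = Suc m" "{v, u} \<in> edges (delete_edges B Y)"
      "reach (delete_edges B Y) m u w"
      using False reach_first_step by metis
    then show ?thesis using through[of u m] by (simp add: algebra_simps)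
  next
    case True
    obtain t where t: "t \<in> verts B" "t \<noteq> v"
      using assms(4) v by (metis card_le_Suc0_iff_eq card.infinite One_nat_def not_less not_less_zero)
    have "reach (delete_edges B Y) s v t"
      using B Y v t by (intro fault_tolerantD)
    then obtain u where vu: "{v, u} \<in> edges (delete_edges B Y)"
      using t reach_first_step by metis
    then have "reach (delete_edges B Y) 1 u w"
      using True by (intro reach_edge) (simp add: insert_commute)
    from through[OF vu this] show ?thesis
      using assms(3) by (auto elim: reach_mono)
  qed
qed

text \<open>Choosing the base walk so as to avoid \<open>b\<close> of the base edges below faults disposes of at least
  \<open>b\<close> faults. Hence the number of spoiled lifts and of faults in the two end fibres is at most
  \<open>a + 1\<close> in total. Forbidding the steps from \<open>x\<close> to the other points with a spoiled lift costs one
  edge less than there are spoiled lifts, if the lift at \<open>x\<close> is one of them; this saves the one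
  fault by which \<open>a\<close> was exceeded.\<close>

lemma reach_of_sparse_faults:
  assumes F: "fault_tolerant a r F" and B: "fault_tolerant b s B"
    and "2 \<le> r" and "1 < card (verts F)" and X: "finite X"
    and v: "v \<in> verts B" and w: "w \<in> verts B" and "v \<noteq> w"
    and x: "x \<in> verts (fibre v)" and y: "y \<in> verts (fibre w)"
    and total: "card X \<le> a + b + 1"
    and many: "b < card {f. \<exists>e\<in>X. p (Edge e) = Edge f}"
  shows "reach (delete_edges G X) (r + s) x y"
proof -
  let ?faulty = "{f. \<exists>e\<in>X. p (Edge e) = Edge f}"
  obtain Y where Y: "Y \<subseteq> ?faulty" "card Y = b" "finite Y"
    using obtain_subset_with_card_n[of b ?faulty] many by auto
  have "reach (delete_edges B Y) s v w"
    using B Y v w by (intro fault_tolerantD) auto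
  then obtain T where T: "graph_iso T (fibre v) (fibre w)"
    and cardT: "card {z \<in> verts (fibre v). \<not> reach (delete_edges G X) s z (T z)}
      \<le> card {e \<in> X. \<exists>f. p (Edge e) = Edge f \<and> f \<notin> Y}"
    using walk_lifts[OF X _ w] by blast
  \<comment> \<open>The points with a spoiled lift; then the faults in the two end fibres, those above base edges
    that the walk may use, and those above the avoided base edges.\<close>
  define R where "R = {z \<in> verts (fibre v). \<not> reach (delete_edges G X) s z (T z)}"
  define Xv where "Xv = {e \<in> X. p (Edge e) = Vertex v}"
  define Xw where "Xw = {e \<in> X. p (Edge e) = Vertex w}"
  define Xn where "Xn = {e \<in> X. \<exists>f. p (Edge e) = Edge f \<and> f \<notin> Y}"
  define XY where "XY = {e \<in> X. \<exists>f. p (Edge e) = Edge f \<and> f \<in> Y}"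
  have fin: "finite Xv" "finite Xw" "finite Xn" "finite XY" "finite R"
    using X by (auto simp: Xv_def Xw_def Xn_def XY_def R_def finite_verts_fibre)
  have "Y \<subseteq> (\<lambda>e. case p (Edge e) of Edge f \<Rightarrow> f) ` XY"
    using Y(1) by (force simp: XY_def)
  then have XY: "b \<le> card XY"
    using surj_card_le[OF fin(4)] Y(2) by blast
  have "?faulty \<subseteq> (\<lambda>e. case p (Edge e) of Edge f \<Rightarrow> f) ` (Xn \<union> XY)"
    by (force simp: Xn_def XY_def)
  then have "card ?faulty \<le> card (Xn \<union> XY)"
    using fin by (intro surj_card_le) auto
  then have above: "b < card (Xn \<union> XY)" using many by linarith
  have "Xv \<inter> Xw = {}" "Xn \<inter> XY = {}" "(Xv \<union> Xw) \<inter> (Xn \<union> XY) = {}"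
    using \<open>v \<noteq> w\<close> by (auto simp: Xv_def Xw_def Xn_def XY_def)
  then have "card (Xn \<union> XY) = card Xn + card XY"
    and "card ((Xv \<union> Xw) \<union> (Xn \<union> XY)) = card Xv + card Xw + card (Xn \<union> XY)"
    using fin card_Un_disjoint[of Xv Xw] card_Un_disjoint[of Xn XY]
      card_Un_disjoint[of "Xv \<union> Xw" "Xn \<union> XY"] by simp_all
  moreover have "card ((Xv \<union> Xw) \<union> (Xn \<union> XY)) \<le> card X"
    using X by (intro card_mono) (auto simp: Xv_def Xw_def Xn_def XY_def)
  moreover have "card R \<le> card Xn" using cardT by (simp add: R_def Xn_def)
  ultimately have sum: "card Xv + card Xw + card R \<le> a + 1"
    and le: "card Xv \<le> a" "card Xw \<le> a"
    using total XY above by linarith+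
  have lift: "reach (delete_edges G X) s z (T z)" if "z \<in> verts (fibre v)" "z \<notin> R" for z
    using that by (simp add: R_def)
  have bij: "bij_betw T (verts (fibre v)) (verts (fibre w))" using T by (simp add: graph_iso_def)
  have "y \<in> T ` verts (fibre v)" using bij y by (simp add: bij_betw_def)
  then obtain y0 where y0: "y0 \<in> verts (fibre v)" "T y0 = y" by (elim imageE) simp
  have Tx: "T x \<in> verts (fibre w)" by (rule bij_betw_apply[OF bij x])
  have ftv: "fault_tolerant a r (fibre v)" and ftw: "fault_tolerant a r (fibre w)"
    using fault_tolerant_fibre[OF F] v w by auto
  have in_v: "reach (delete_edges G X) n z z'"
    if "reach (delete_edges (fibre v) Z) n z z'" "Xv \<subseteq> Z" for n z z' Z
    using that by (intro reach_fibre_imp_reach[of v Z]) (auto simp: Xv_def)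
  have in_w: "reach (delete_edges G X) n z z'"
    if "reach (delete_edges (fibre w) Xw) n z z'" for n z z'
    using that by (intro reach_fibre_imp_reach[of w Xw]) (auto simp: Xw_def)
  consider "x \<notin> R" | "y0 \<notin> R" | "x \<in> R" "y0 \<in> R" by blast
  then show ?thesis
  proof cases
    case 1
    have "reach (delete_edges G X) r (T x) y"
      using ftw fin le Tx y by (intro in_w fault_tolerantD)
    then show ?thesis using reach_trans[OF lift[OF x 1]] by (simp add: add.commute)
  next
    case 2
    have "reach (delete_edges G X) r x y0"
      using ftv fin le x y0 by (intro in_v[of Xv] fault_tolerantD) auto
    then show ?thesis using reach_trans[OF _ lift[OF y0(1) 2]] y0(2) by simp
  next
    case 3
    \<comment> \<open>The faults of both end fibres, seen in the fibre over \<open>v\<close>, and the edges from \<open>x\<close> to the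
      other points with a spoiled lift: at most \<open>a\<close> edges, as \<open>x\<close> itself has a spoiled lift.\<close>
    define Xw' where "Xw' = image (inv_into (verts (fibre v)) T) ` Xw"
    define Z where "Z = Xv \<union> Xw' \<union> (\<lambda>z. {x, z}) ` (R - {x})"
    have "card Xw' \<le> card Xw" unfolding Xw'_def by (rule card_image_le[OF fin(2)])
    moreover have "card ((\<lambda>z. {x, z}) ` (R - {x})) \<le> card R - 1"
      using card_image_le[of "R - {x}" "\<lambda>z. {x, z}"] fin 3 by simp
    moreover have "0 < card R" using fin 3 by (auto simp: card_gt_0_iff)
    moreover have "card Z \<le> card Xv + card Xw' + card ((\<lambda>z. {x, z}) ` (R - {x}))"
      using card_Un_le[of "Xv \<union> Xw'" "(\<lambda>z. {x, z}) ` (R - {x})"] card_Un_le[of Xv Xw']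
      unfolding Z_def by linarith
    ultimately have Z: "finite Z" "card Z \<le> a"
      using sum fin by (auto simp: Z_def Xw'_def)
    have sibling: "reach (delete_edges G X) n (T z) (T z')"
      if "reach (delete_edges (fibre v) Z) n z z'" for n z z'
    proof (rule in_w)
      show "reach (delete_edges (fibre w) Xw) n (T z) (T z')"
        by (rule graph_iso_reach[OF T fibre_edge_subset _ that]) (auto simp: Z_def Xw'_def)
    qed
    have start: "reach (delete_edges G X) (1 + s) x (T z)"
      if xz: "{x, z} \<in> edges (delete_edges (fibre v) Z)" for z
    proof -
      have "{x, z} \<subseteq> verts (fibre v)" using xz by (intro bspec[OF fibre_edge_subset]) simp
      then have e: "{x, z} \<in> edges G" "{x, z} \<notin> Z" "z \<in> verts (fibre v)"
        using xz by (simp_all add: in_edges_fibre)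
      have "z \<noteq> x" using simple_graph_no_loop[OF simple_G e(1)] by simp
      then have "z \<notin> R" using e by (auto simp: Z_def)
      have "reach (delete_edges G X) 1 x z"
        by (rule in_v[OF reach_edge[OF xz]]) (auto simp: Z_def)
      from reach_trans[OF this lift[OF e(3) \<open>z \<notin> R\<close>]] show ?thesis .
    qed
    show ?thesis
    proof (cases "x = y0")
      case False
      have "reach (delete_edges (fibre v) Z) r x y0"
        using ftv Z x y0(1) by (intro fault_tolerantD)
      then obtain m z where m: "r = Suc m" and xz: "{x, z} \<in> edges (delete_edges (fibre v) Z)"
        and zy: "reach (delete_edges (fibre v) Z) m z y0"
        using False reach_first_step by metis
      from reach_trans[OF start[OF xz] sibling[OF zy]] show ?thesis
        using y0(2) m by (simp add: add.commute)
    next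
      case True
      \<comment> \<open>The lift is sandwiched between a step to a neighbour of \<open>x\<close> and the image of the step back;
        such a neighbour is the first point on the way to any other point \<open>t\<close>.\<close>
      have "card (verts (fibre v)) = card (verts F)"
        using vertex_fibre_iso[OF v] by (auto simp: graph_iso_def dest: bij_betw_same_card)
      then obtain t where t: "t \<in> verts (fibre v)" "t \<noteq> x"
        using assms(4) x
        by (metis card_le_Suc0_iff_eq card.infinite One_nat_def not_less not_less_zero)
      have "reach (delete_edges (fibre v) Z) r x t"
        using ftv Z x t(1) by (intro fault_tolerantD)
      then obtain z where xz: "{x, z} \<in> edges (delete_edges (fibre v) Z)"
        using t reach_first_step by metis
      then have "reach (delete_edges (fibre v) Z) 1 z y0"
        using True by (intro reach_edge) (simp add: insert_commute)
      from reach_trans[OF start[OF xz] sibling[OF this]] show ?thesis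
        using y0(2) assms(3) by (auto elim: reach_mono)
    qed
  qed
qed

theorem fault_tolerant_bundle:
  assumes F: "fault_tolerant a r F" and B: "fault_tolerant b s B"
    and "2 \<le> r" and "2 \<le> s" and "1 < card (verts F)" and "1 < card (verts B)"
  shows "fault_tolerant (a + b + 1) (r + s) G"
  unfolding fault_tolerant_def
proof (intro allI impI ballI)
  fix X :: "'g set set" and x y :: 'g
  assume X: "finite X" "card X \<le> a + b + 1" and xy: "x \<in> verts G" "y \<in> verts G"
  have in_some_fibre: "\<exists>v\<in>verts B. z \<in> verts (fibre v)" if "z \<in> verts G" for z
  proof -
    have "p (Vertex z) \<in> Vertex ` verts B" using graph_map_p that by (simp add: graph_map_def)
    then show ?thesis using that by (auto simp: in_verts_fibre)
  qed
  obtain v where v: "v \<in> verts B" and x: "x \<in> verts (fibre v)"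
    using in_some_fibre[OF xy(1)] by blast
  obtain w where w: "w \<in> verts B" and y: "y \<in> verts (fibre w)"
    using in_some_fibre[OF xy(2)] by blast
  let ?Xv = "{e \<in> X. p (Edge e) = Vertex v}"
  let ?faulty = "{f. \<exists>e\<in>X. p (Edge e) = Edge f}"
  have "card X = card ?Xv + card {e \<in> X. p (Edge e) \<noteq> Vertex v}"
    using X(1) by (subst card_Un_disjoint[symmetric]) (auto intro: arg_cong[where f = card])
  then consider "card {e \<in> X. p (Edge e) \<noteq> Vertex v} \<le> b"
    | "card ?Xv \<le> a" "v = w \<or> card ?faulty \<le> b"
    | "v \<noteq> w" "b < card ?faulty"
    using X(2) by linarith
  then show "reach (delete_edges G X) (r + s) x y"
  proof cases
    case 1
    show ?thesis by (rule reach_of_crowded_fibre[OF F B assms(4,6) X(1) v w x y 1])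
  next
    case 2
    have "?faulty \<subseteq> (\<lambda>e. case p (Edge e) of Edge f \<Rightarrow> f) ` X" by force
    then have "finite ?faulty" by (rule finite_surj[OF X(1)])
    have "\<exists>x'. x' \<in> verts (fibre v) \<and> reach (delete_edges G X) s y x'"
    proof (cases "v = w")
      case True
      then show ?thesis using y by (intro exI[of _ y]) (simp add: reach_refl)
    next
      case False
      then have "reach (delete_edges B ?faulty) s w v"
        using B 2 v w \<open>finite ?faulty\<close> by (intro fault_tolerantD) auto
      then show ?thesis by (rule fault_free_lift[OF X(1) _ v _ y]) auto
    qed
    then obtain x' where x': "x' \<in> verts (fibre v)" "reach (delete_edges G X) s y x'" by blast
    have "reach (delete_edges (fibre v) ?Xv) r x x'"
      using fault_tolerantD[OF fault_tolerant_fibre[OF F v]] 2 X x x' by simp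
    then have "reach (delete_edges G X) r x x'"
      by (rule reach_fibre_imp_reach) simp
    from reach_trans[OF this reach_sym[OF x'(2)]] show ?thesis .
  next
    case 3
    show ?thesis by (rule reach_of_sparse_faults[OF F B assms(3,5) X(1) v w 3(1) x y X(2) 3(2)])
  qed
qed

end

theorem theorem5p4:
  fixes F :: "'f sgraph" and B :: "'b sgraph" and G :: "'g sgraph"
    and kF kB a b :: nat
  assumes "simple_graph F" and "simple_graph B" and "simple_graph G"
    and "edge_connected kF F" and "edge_connected kB B"
    and "cartesian_bundle G F B"
    and "a < kF" and "b < kB"
    and "edge_fault_diameter a F \<ge> 2" and "edge_fault_diameter b B \<ge> 2"
  shows "edge_fault_diameter (a + b + 1) G \<le> edge_fault_diameter a F + edge_fault_diameter b B"
proof (cases "edge_fault_diameter a F = \<infinity> \<or> edge_fault_diameter b B = \<infinity>")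
  case True
  then show ?thesis by auto
next
  case False
  then obtain r s where r: "edge_fault_diameter a F = enat r" and s: "edge_fault_diameter b B = enat s"
    by auto
  obtain p where "graph_map p G B"
    and "\<forall>v\<in>verts B. \<exists>f. graph_iso f (vertex_fibre p G v) F"
    and "\<forall>u v. {u, v} \<in> edges B \<longrightarrow>
           (\<exists>f. graph_iso f (edge_fibre p G {u, v}) (cartesian_product F K2) \<and>
                f ` verts (vertex_fibre p G u) = verts F \<times> {False} \<and>
                f ` verts (vertex_fibre p G v) = verts F \<times> {True})"
    using assms(6) unfolding cartesian_bundle_def by (elim exE conjE)
  then interpret graph_bundle F B G p
    by unfold_locales (use assms(1-3) in \<open>simp_all\<close>)
  have card: "1 < card (verts F)" "1 < card (verts B)"
    using assms(4,5) by (auto simp: edge_connected_def graph_connected_def)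
  have "2 \<le> r" "2 \<le> s"
    using assms(9,10) r s by (simp_all add: numeral_eq_enat)
  then have ft: "fault_tolerant (a + b + 1) (r + s) G"
    using card edge_fault_diameter_imp_fault_tolerant[OF simple_F r]
      edge_fault_diameter_imp_fault_tolerant[OF simple_B s]
    by (intro fault_tolerant_bundle)
  have "verts B \<noteq> {}" using card by auto
  then obtain v where v: "v \<in> verts B" by blast
  have "card (verts F) = card (verts (fibre v))"
    using vertex_fibre_iso[OF v] by (auto simp: graph_iso_def dest: bij_betw_same_card)
  also have "\<dots> \<le> card (verts G)"
    using simple_G by (intro card_mono) (auto simp: simple_graph_def in_verts_fibre)
  finally have "1 < card (verts G)" using card by simp
  from fault_tolerant_imp_edge_fault_diameter_le[OF simple_G this ft]
  show ?thesis using r s by simp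
qed

end
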